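(* Let $\mathbf{A}$ be an incomplete or complete $n\times n$ multiplicative pairwise comparison matrix whose associated graph $G$ is connected. Let $T^1,\dots,T^S$ be all the spanning trees of $G$, and for each $s=1,\dots,S$ let $\mathbf{w}^s\in\mathbb{R}^n_{>0}$ be a weight vector calculated from $T^s$, i.e. a positive vector with $w^s_i/w^s_j=a_{ij}$ for every edge $\{i,j\}$ of $T^s$ (such a vector exists and is unique up to a positive scalar multiplier). Then the optimal solution of the logarithmic least squares problem $$\min \sum_{\substack{i,j:\\ a_{ij}\text{ is known}}}\left[\log a_{ij}-\log\left(\frac{w_i}{w_j}\right)\right]^2\qquad\text{subject to } w_i>0,\ i=1,2,\dots,n,$$ is equal, up to a scalar multiplier, to the geometric mean of the weight vectors calculated from all spanning trees; that is, a vector $\mathbf{w}\in\mathbb{R}^n_{>0}$ is an optimal solution if and only if there is a constant $c>0$ such that $$w_i=c\left(\prod_{s=1}^S w^s_i\right)^{1/S},\qquad i=1,2,\dots,n.$$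
   Context: An incomplete or complete multiplicative pairwise comparison matrix of size $n\times n$ is an array $\mathbf{A}=[a_{ij}]_{i,j=1,\dots,n}$ in which each entry is either a known positive real number or missing, such that the diagonal entries are known and equal to $1$, $a_{ij}$ is known if and only if $a_{ji}$ is known, and $a_{ij}=1/a_{ji}$ for all known entries. "Incomplete" means "not necessarily complete": the number of missing entries may be zero. The graph $G$ associated with $\mathbf{A}$ is the undirected simple graph on the node set $\{1,\dots,n\}$ in which distinct nodes $i$ and $j$ are joined by an edge if and only if $a_{ij}$ is known. Spanning trees are counted as labelled subgraphs of $G$, that is, distinct edge sets give distinct spanning trees. *)

theory Defs
  imports "HOL-Analysis.Analysis"
begin

text \<open>
  A matrix of size \<open>n \<times> n\<close> is indexed by a finite type \<open>'n\<close> with \<open>n\<close> elements;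
  the entry \<open>None\<close> stands for a missing comparison.
\<close>

definition pairwise_comparison_matrix :: "real option ^ 'n ^ 'n \<Rightarrow> bool" where
  "pairwise_comparison_matrix A \<longleftrightarrow>
     (\<forall>i. A $ i $ i = Some 1) \<and>
     (\<forall>i j x. A $ i $ j = Some x \<longrightarrow> x > 0) \<and>
     (\<forall>i j. A $ i $ j \<noteq> None \<longleftrightarrow> A $ j $ i \<noteq> None) \<and>
     (\<forall>i j x y. A $ i $ j = Some x \<longrightarrow> A $ j $ i = Some y \<longrightarrow> x = 1 / y)"

text \<open>
  A simple graph on the vertex set \<open>UNIV :: 'n set\<close> is given by its set of edges,
  an edge being the two-element set of its endpoints.
\<close>

definition comparison_graph :: "real option ^ 'n ^ 'n \<Rightarrow> 'n set set" where
  "comparison_graph A = {{i, j} | i j. i \<noteq> j \<and> A $ i $ j \<noteq> None}"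

definition graph_connected :: "'n set set \<Rightarrow> bool" where
  "graph_connected E \<longleftrightarrow> (\<forall>u v. (u, v) \<in> {(i, j). {i, j} \<in> E}\<^sup>*)"

definition graph_cycle :: "'n set set \<Rightarrow> 'n list \<Rightarrow> bool" where
  "graph_cycle E p \<longleftrightarrow> length p \<ge> 3 \<and> distinct p \<and>
     (\<forall>k < length p. {p ! k, p ! (Suc k mod length p)} \<in> E)"

definition graph_tree :: "'n set set \<Rightarrow> bool" where
  "graph_tree E \<longleftrightarrow> graph_connected E \<and> (\<nexists>p. graph_cycle E p)"

text \<open>
  A spanning tree contains all vertices, so it is determined by its edge set. The notion
  of spanning tree in the AFP entry Graph_Theory excludes directed cycles only (an
  acyclically oriented triangle is a tree there), so it is not used for undirected graphs.
\<close>

definition spanning_trees :: "'n set set \<Rightarrow> 'n set set set" where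
  "spanning_trees E = {T. T \<subseteq> E \<and> graph_tree T}"

definition positive_vec :: "real ^ 'n \<Rightarrow> bool" where
  "positive_vec w \<longleftrightarrow> (\<forall>i. w $ i > 0)"

definition tree_weight_vector ::
    "real option ^ 'n ^ 'n \<Rightarrow> 'n set set \<Rightarrow> real ^ 'n \<Rightarrow> bool" where
  "tree_weight_vector A T w \<longleftrightarrow>
     positive_vec w \<and> (\<forall>i j. {i, j} \<in> T \<longrightarrow> A $ i $ j = Some (w $ i / w $ j))"

text \<open>
  The sum ranges over ordered pairs: each edge contributes twice, and the diagonal
  contributes zero.
\<close>

definition log_least_squares :: "real option ^ 'n ^ 'n \<Rightarrow> real ^ 'n \<Rightarrow> real" where
  "log_least_squares A w =
     (\<Sum>(i, j) \<in> {(i, j). A $ i $ j \<noteq> None}. (ln (the (A $ i $ j)) - ln (w $ i / w $ j))\<^sup>2)"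

definition lls_optimal :: "real option ^ 'n ^ 'n \<Rightarrow> real ^ 'n \<Rightarrow> bool" where
  "lls_optimal A w \<longleftrightarrow> is_arg_min (log_least_squares A) positive_vec w"

end

theory Submission
  imports Defs
begin

text \<open>
  On the logarithmic scale, with \<open>b i j = ln a\<^sub>i\<^sub>j\<close> (antisymmetric) and \<open>y i = ln w\<^sub>i\<close>, the
  objective is the quadratic \<open>\<Sum> (b i j - (y i - y j))\<^sup>2\<close>. If the residuals
  \<open>b i j - (y i - y j)\<close> sum to zero over the neighbours \<open>j\<close> of every vertex \<open>i\<close> (the normal
  equations), then moving from \<open>y\<close> to \<open>y + h\<close> increases the objective by exactly
  \<open>\<Sum> (h i - h j)\<^sup>2\<close> (\<open>least_squares_shift\<close>); by connectedness the minimisers are then the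
  vectors that differ from \<open>y\<close> by a constant. So it suffices that the arithmetic mean of the
  logarithmic tree solutions, which is the logarithm of the geometric mean of the tree weight
  vectors, satisfies the normal equations.

  Fix \<open>i\<close>. The sum of the residuals at \<open>i\<close>, over all spanning trees \<open>T\<close> and all neighbours \<open>j\<close>,
  vanishes because its terms cancel in pairs (\<open>tree_residuals_sum_zero\<close>). Let \<open>k\<close> be the first
  vertex after \<open>i\<close> on the path in \<open>T\<close> from \<open>i\<close> to \<open>j\<close>. Adding \<open>{i, j}\<close> to \<open>T\<close> closes a cycle
  whose two edges at \<open>i\<close> are \<open>{i, j}\<close> and \<open>{i, k}\<close>, and removing the latter gives another
  spanning tree \<open>T'\<close>. The residual of \<open>T\<close> on \<open>{i, j}\<close> is the sum of \<open>b\<close> around this cycle in one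
  direction, and that of \<open>T'\<close> on \<open>{i, k}\<close> is the sum around the same cycle in the opposite
  direction. The map \<open>(T, j) \<mapsto> (T', k)\<close> is therefore a sign-reversing involution; if \<open>{i, j}\<close> is
  already in \<open>T\<close>, the pair is fixed and its residual is zero.

  Throughout, acyclicity is used in the form that every edge is a bridge
  (\<open>acyclic_imp_all_bridges\<close>, \<open>all_bridges_imp_acyclic\<close>), which is stable under the exchange of
  edges and turns all arguments about cycles into arguments about reachability.
\<close>

section \<open>Reachability and bridges\<close>

definition joined :: "'v set set \<Rightarrow> ('v \<times> 'v) set" where
  "joined E = {(i, j). {i, j} \<in> E}\<^sup>*"

definition all_bridges :: "'v set set \<Rightarrow> bool" where
  "all_bridges E \<longleftrightarrow> (\<forall>u v. {u, v} \<in> E \<longrightarrow> (u, v) \<notin> joined (E - {{u, v}}))"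

lemma graph_connected_iff_joined: "graph_connected E \<longleftrightarrow> (\<forall>u v. (u, v) \<in> joined E)"
  by (simp add: graph_connected_def joined_def)

lemma joined_refl: "(u, u) \<in> joined E"
  by (simp add: joined_def)

lemma joined_edge: "{u, v} \<in> E \<Longrightarrow> (u, v) \<in> joined E"
  by (auto simp: joined_def)

lemma joined_trans: "(u, v) \<in> joined E \<Longrightarrow> (v, w) \<in> joined E \<Longrightarrow> (u, w) \<in> joined E"
  by (simp add: joined_def)

lemma joined_sym: "(u, v) \<in> joined E \<Longrightarrow> (v, u) \<in> joined E"
proof -
  have "sym {(i, j). {i, j} \<in> E}"
    by (auto simp: sym_def insert_commute)
  then show "(u, v) \<in> joined E \<Longrightarrow> (v, u) \<in> joined E"
    unfolding joined_def by (meson sym_rtrancl symD)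
qed

lemma joined_induct [consumes 1, case_names refl step]:
  assumes "(u, v) \<in> joined E"
    and "P u"
    and "\<And>x y. (u, x) \<in> joined E \<Longrightarrow> {x, y} \<in> E \<Longrightarrow> P x \<Longrightarrow> P y"
  shows "P v"
  using assms unfolding joined_def by (induction rule: rtrancl_induct) auto

lemma joined_subsetI:
  assumes "\<And>x y. {x, y} \<in> E \<Longrightarrow> (x, y) \<in> joined F"
  shows "joined E \<subseteq> joined F"
proof (rule subrelI)
  fix u v assume "(u, v) \<in> joined E"
  then show "(u, v) \<in> joined F"
    by (induction rule: joined_induct) (auto intro: joined_refl joined_trans assms)
qed

lemma joined_mono: "E \<subseteq> F \<Longrightarrow> joined E \<subseteq> joined F"
  by (rule joined_subsetI) (auto intro: joined_edge)

lemma joined_insertD: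
  assumes "(u, v) \<in> joined (insert {i, j} E)"
  shows "(u, v) \<in> joined E \<or> (u, i) \<in> joined E \<and> (j, v) \<in> joined E
    \<or> (u, j) \<in> joined E \<and> (i, v) \<in> joined E"
  using assms
proof (induction rule: joined_induct)
  case refl
  then show ?case by (simp add: joined_refl)
next
  case (step x y)
  show ?case
  proof (cases "{x, y} \<in> E")
    case True
    then show ?thesis using step.IH by (meson joined_edge joined_trans)
  next
    case False
    then have "x = i \<and> y = j \<or> x = j \<and> y = i"
      using step.hyps by (auto simp: doubleton_eq_iff)
    then show ?thesis using step.IH by (meson joined_refl joined_trans joined_sym)
  qed
qed

lemma joined_remove_redundant:
  assumes "(u, v) \<in> joined (E - {{u, v}})"
  shows "joined (E - {{u, v}}) = joined E"
proof
  show "joined E \<subseteq> joined (E - {{u, v}})"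
  proof (rule joined_subsetI)
    fix x y assume "{x, y} \<in> E"
    then show "(x, y) \<in> joined (E - {{u, v}})"
      using assms by (cases "{x, y} = {u, v}") (auto simp: doubleton_eq_iff intro: joined_edge joined_sym)
  qed
qed (auto intro: joined_mono[THEN subsetD])

lemma all_bridges_mono:
  assumes "all_bridges F" "E \<subseteq> F"
  shows "all_bridges E"
  unfolding all_bridges_def
proof (intro allI impI)
  fix u v assume "{u, v} \<in> E"
  then have "(u, v) \<notin> joined (F - {{u, v}})"
    using assms by (auto simp: all_bridges_def)
  then show "(u, v) \<notin> joined (E - {{u, v}})"
    using joined_mono[of "E - {{u, v}}" "F - {{u, v}}"] assms(2) by blast
qed

lemma joined_imp_distinct_path:
  assumes "(u, v) \<in> joined E"
  shows "\<exists>p. p \<noteq> [] \<and> hd p = u \<and> last p = v \<and> distinct p \<and> successively (\<lambda>a b. {a, b} \<in> E) p"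
  using assms
proof (induction rule: joined_induct)
  case refl
  show ?case by (rule exI[of _ "[u]"]) simp
next
  case (step x y)
  then obtain p where p: "p \<noteq> []" "hd p = u" "last p = x" "distinct p"
    "successively (\<lambda>a b. {a, b} \<in> E) p" by blast
  show ?case
  proof (cases "y \<in> set p")
    case True
    then obtain xs ys where "p = xs @ y # ys" by (meson split_list)
    then show ?thesis
      using p by (intro exI[of _ "xs @ [y]"]) (auto simp: successively_append_iff hd_append)
  next
    case False
    then show ?thesis
      using p step.hyps by (intro exI[of _ "p @ [y]"]) (auto simp: successively_append_iff)
  qed
qed

text \<open>
  A simple path between the endpoints of an edge that avoids this edge has at least three
  vertices, so the edge closes it to a cycle.
\<close>

lemma acyclic_imp_all_bridges:
  assumes acyclic: "\<nexists>p. graph_cycle E p"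
    and no_loops: "\<And>u. {u, u} \<notin> E"
  shows "all_bridges E"
  unfolding all_bridges_def
proof (intro allI impI notI)
  fix u v assume uv: "{u, v} \<in> E" and "(u, v) \<in> joined (E - {{u, v}})"
  then obtain p where p: "p \<noteq> []" "hd p = u" "last p = v" "distinct p"
    and path: "successively (\<lambda>a b. {a, b} \<in> E - {{u, v}}) p"
    using joined_imp_distinct_path by metis
  have "u \<noteq> v" using uv no_loops by auto
  have len: "length p \<ge> 3"
  proof (rule ccontr)
    assume "\<not> 3 \<le> length p"
    then have "length p = 1 \<or> length p = 2" using p(1) by (simp add: numeral_3_eq_3 flip: length_greater_0_conv) linarith
    then show False
      using p path \<open>u \<noteq> v\<close> by (auto simp: length_Suc_conv numeral_2_eq_2)
  qed
  have "{p ! k, p ! (Suc k mod length p)} \<in> E" if k: "k < length p" for k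
  proof (cases "Suc k < length p")
    case True
    then show ?thesis using path by (auto simp: successively_conv_nth)
  next
    case False
    then have "Suc k = length p" using k by simp
    then have "p ! k = v" "p ! (Suc k mod length p) = u"
      using p by (auto simp: last_conv_nth hd_conv_nth simp flip: \<open>Suc k = length p\<close>)
    then show ?thesis using uv by (simp add: insert_commute)
  qed
  then have "graph_cycle E p" using len p(4) by (simp add: graph_cycle_def)
  then show False using acyclic by blast
qed

lemma all_bridges_imp_acyclic:
  assumes "all_bridges E"
  shows "\<nexists>p. graph_cycle E p"
proof
  assume "\<exists>p. graph_cycle E p"
  then obtain p where len: "length p \<ge> 3" and dist: "distinct p"
    and edges: "\<And>k. k < length p \<Longrightarrow> {p ! k, p ! (Suc k mod length p)} \<in> E"
    by (auto simp: graph_cycle_def)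
  define m where "m = length p - 1"
  have m: "length p = Suc m" "2 \<le> m" using len by (auto simp: m_def)
  have closing: "{p ! 0, p ! m} \<in> E" using edges[of m] m by (simp add: insert_commute)
  have "k \<le> m \<Longrightarrow> (p ! 0, p ! k) \<in> joined (E - {{p ! 0, p ! m}})" for k
  proof (induction k)
    case 0
    show ?case by (rule joined_refl)
  next
    case (Suc k)
    have "{p ! k, p ! Suc k} \<in> E" using edges[of k] Suc.prems m by simp
    moreover have "{p ! k, p ! Suc k} \<noteq> {p ! 0, p ! m}"
      using Suc.prems m dist by (auto simp: doubleton_eq_iff nth_eq_iff_index_eq)
    ultimately have "(p ! k, p ! Suc k) \<in> joined (E - {{p ! 0, p ! m}})"
      by (intro joined_edge) simp
    then show ?case using Suc by (meson Suc_leD joined_trans)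
  qed
  then have "(p ! 0, p ! m) \<in> joined (E - {{p ! 0, p ! m}})" by simp
  then show False using assms closing by (auto simp: all_bridges_def)
qed

lemma mem_spanning_trees_iff:
  assumes "\<And>u. {u, u} \<notin> E"
  shows "T \<in> spanning_trees E \<longleftrightarrow> T \<subseteq> E \<and> graph_connected T \<and> all_bridges T"
  using assms acyclic_imp_all_bridges[of T] all_bridges_imp_acyclic[of T]
  unfolding spanning_trees_def graph_tree_def by blast

text \<open>A connected subgraph with the fewest edges is a spanning tree.\<close>

lemma ex_spanning_tree:
  fixes E :: "'v::finite set set"
  assumes no_loops: "\<And>u. {u, u} \<notin> E" and conn: "graph_connected E"
  shows "spanning_trees E \<noteq> {}"
proof -
  obtain T where T: "T \<subseteq> E" "graph_connected T"
    and min: "\<And>F. F \<subseteq> E \<Longrightarrow> graph_connected F \<Longrightarrow> card T \<le> card F"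
    using ex_has_least_nat[of "\<lambda>F. F \<subseteq> E \<and> graph_connected F" E card] conn by blast
  have "all_bridges T"
    unfolding all_bridges_def
  proof (intro allI impI notI)
    fix u v assume uv: "{u, v} \<in> T" and "(u, v) \<in> joined (T - {{u, v}})"
    then have "graph_connected (T - {{u, v}})"
      using T(2) by (simp add: graph_connected_iff_joined joined_remove_redundant)
    then have "card T \<le> card (T - {{u, v}})" using T(1) by (intro min) auto
    then show False using uv card_Diff1_less[of T "{u, v}"] by simp
  qed
  then have "T \<in> spanning_trees E" using T mem_spanning_trees_iff[of E T, OF no_loops] by simp
  then show ?thesis by blast
qed

section \<open>Exchanging an edge at a vertex of a tree\<close>

definition avoiding :: "'v \<Rightarrow> 'v set set \<Rightarrow> 'v set set" where
  "avoiding i E = {e \<in> E. i \<notin> e}"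

lemma joined_avoiding: "(u, v) \<in> joined (avoiding i E) \<Longrightarrow> (u, v) \<in> joined (E - {{i, w}})"
  using joined_mono[of "avoiding i E" "E - {{i, w}}"] by (auto simp: avoiding_def)

text \<open>In a tree, \<open>first_step T i j\<close> is the vertex after \<open>i\<close> on the path from \<open>i\<close> to \<open>j\<close>.\<close>

definition first_step :: "'v set set \<Rightarrow> 'v \<Rightarrow> 'v \<Rightarrow> 'v" where
  "first_step T i j = (THE k. {i, k} \<in> T \<and> (k, j) \<in> joined (avoiding i T))"

text \<open>
  If two neighbours of \<open>i\<close> both reach \<open>j\<close> without passing through \<open>i\<close>, the edge from \<open>i\<close> to one of
  them can be bypassed via the other, so it is not a bridge.
\<close>

lemma first_step_unique:
  assumes "all_bridges T"
    and k: "{i, k} \<in> T" "(k, j) \<in> joined (avoiding i T)"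
    and l: "{i, l} \<in> T" "(l, j) \<in> joined (avoiding i T)"
  shows "k = l"
proof (rule ccontr)
  assume "k \<noteq> l"
  then have "(i, l) \<in> joined (T - {{i, k}})"
    using l(1) by (intro joined_edge) (auto simp: doubleton_eq_iff)
  moreover have "(l, k) \<in> joined (T - {{i, k}})"
    using k(2) l(2) by (meson joined_avoiding joined_sym joined_trans)
  ultimately have "(i, k) \<in> joined (T - {{i, k}})" by (rule joined_trans)
  then show False
    using assms(1) k(1) by (simp add: all_bridges_def)
qed

lemma first_step_exists:
  assumes "(i, j) \<in> joined T" "i \<noteq> j"
  shows "\<exists>k. {i, k} \<in> T \<and> (k, j) \<in> joined (avoiding i T)"
proof -
  have "j = i \<or> (\<exists>k. {i, k} \<in> T \<and> (k, j) \<in> joined (avoiding i T))"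
    using assms(1)
  proof (induction rule: joined_induct)
    case (step x y)
    show ?case
    proof (cases "x = i \<or> y = i")
      case True
      then show ?thesis using step.hyps by (auto intro: joined_refl)
    next
      case False
      then have "(x, y) \<in> joined (avoiding i T)"
        using step.hyps by (intro joined_edge) (auto simp: avoiding_def)
      then show ?thesis using step.IH False by (meson joined_trans)
    qed
  qed simp
  then show ?thesis using assms(2) by simp
qed

lemma first_step_eq:
  assumes "all_bridges T" "{i, k} \<in> T" "(k, j) \<in> joined (avoiding i T)"
  shows "first_step T i j = k"
  unfolding first_step_def using assms by (blast intro: first_step_unique)

definition exchange :: "'v \<Rightarrow> 'v set set \<times> 'v \<Rightarrow> 'v set set \<times> 'v" where
  "exchange i = (\<lambda>(T, j). (insert {i, j} (T - {{i, first_step T i j}}), first_step T i j))"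

lemma connected_exchange:
  assumes "graph_connected T" and kj: "(k, j) \<in> joined (avoiding i T)"
  shows "graph_connected (insert {i, j} (T - {{i, k}}))" (is "graph_connected ?T'")
proof -
  have "(i, j) \<in> joined ?T'" by (intro joined_edge) simp
  moreover have "(j, k) \<in> joined ?T'"
    by (rule joined_sym, rule subsetD[OF joined_mono joined_avoiding[OF kj]]) (rule subset_insertI)
  ultimately have ik: "(i, k) \<in> joined ?T'" by (rule joined_trans)
  have "joined T \<subseteq> joined ?T'"
  proof (rule joined_subsetI)
    fix x y assume "{x, y} \<in> T"
    then show "(x, y) \<in> joined ?T'"
      using ik by (cases "{x, y} = {i, k}") (auto simp: doubleton_eq_iff intro: joined_edge joined_sym)
  qed
  then show ?thesis using assms(1) by (auto simp: graph_connected_iff_joined)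
qed

text \<open>
  A cycle in the new graph has to use \<open>{i, j}\<close>, since \<open>T\<close> has no cycles; so it would join \<open>i\<close> to
  \<open>j\<close>, and hence to \<open>k\<close>, in \<open>T\<close> without \<open>{i, k}\<close>, which is impossible for the bridge \<open>{i, k}\<close>.
\<close>

lemma all_bridges_exchange:
  assumes bridges: "all_bridges T" and ik: "{i, k} \<in> T" and kj: "(k, j) \<in> joined (avoiding i T)"
  shows "all_bridges (insert {i, j} (T - {{i, k}}))" (is "all_bridges ?T'")
proof -
  let ?F = "T - {{i, k}}"
  have not_ij: "(i, j) \<notin> joined ?F"
  proof
    assume "(i, j) \<in> joined ?F"
    moreover have "(j, k) \<in> joined ?F" using joined_avoiding[OF kj] by (rule joined_sym)
    ultimately have "(i, k) \<in> joined ?F" by (rule joined_trans)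
    then show False using bridges ik by (simp add: all_bridges_def)
  qed
  show ?thesis
    unfolding all_bridges_def
  proof (intro allI impI notI)
    fix u v assume uv: "{u, v} \<in> ?T'" and joined_uv: "(u, v) \<in> joined (?T' - {{u, v}})"
    show False
    proof (cases "{u, v} = {i, j}")
      case True
      then have "(u, v) \<in> joined ?F"
        using joined_uv joined_mono[of "?T' - {{u, v}}" ?F] by auto
      then show False using True not_ij joined_sym by (fastforce simp: doubleton_eq_iff)
    next
      case False
      then have uvF: "{u, v} \<in> ?F" using uv by simp
      have mono: "joined (?F - {{u, v}}) \<subseteq> joined ?F" by (intro joined_mono) auto
      have "?T' - {{u, v}} = insert {i, j} (?F - {{u, v}})" using False by auto
      then have "(u, v) \<in> joined (?F - {{u, v}})
        \<or> (u, i) \<in> joined (?F - {{u, v}}) \<and> (j, v) \<in> joined (?F - {{u, v}})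
        \<or> (u, j) \<in> joined (?F - {{u, v}}) \<and> (i, v) \<in> joined (?F - {{u, v}})"
        using joined_uv joined_insertD by metis
      moreover have "(u, v) \<notin> joined (?F - {{u, v}})"
        using all_bridges_mono[OF bridges, of ?F] uvF by (auto simp: all_bridges_def)
      ultimately have "(u, i) \<in> joined ?F \<and> (j, v) \<in> joined ?F
        \<or> (u, j) \<in> joined ?F \<and> (i, v) \<in> joined ?F"
        using mono by blast
      then show False
        using not_ij joined_edge[OF uvF] by (meson joined_sym joined_trans)
    qed
  qed
qed

lemma avoiding_exchange: "avoiding i (insert {i, j} (T - {{i, k}})) = avoiding i T"
  by (auto simp: avoiding_def)

lemma first_step_props:
  assumes "graph_connected T" "all_bridges T" "i \<noteq> j"
  shows "{i, first_step T i j} \<in> T" "(first_step T i j, j) \<in> joined (avoiding i T)"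
proof -
  obtain k where "{i, k} \<in> T" "(k, j) \<in> joined (avoiding i T)"
    using first_step_exists[of i j T] assms by (auto simp: graph_connected_iff_joined)
  with first_step_eq[OF assms(2) this]
  show "{i, first_step T i j} \<in> T" "(first_step T i j, j) \<in> joined (avoiding i T)" by simp_all
qed

lemma exchange_spanning_tree:
  assumes no_loops: "\<And>u. {u, u} \<notin> E" and T: "T \<in> spanning_trees E" and ij: "{i, j} \<in> E"
  shows "insert {i, j} (T - {{i, first_step T i j}}) \<in> spanning_trees E"
    and "{i, first_step T i j} \<in> E"
proof -
  have "i \<noteq> j" using ij no_loops by auto
  moreover have tree: "T \<subseteq> E" "graph_connected T" "all_bridges T"
    using T by (auto simp: mem_spanning_trees_iff[of E, OF no_loops])
  ultimately have fs: "{i, first_step T i j} \<in> T" "(first_step T i j, j) \<in> joined (avoiding i T)"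
    by (auto intro: first_step_props)
  show "{i, first_step T i j} \<in> E" using fs tree by blast
  show "insert {i, j} (T - {{i, first_step T i j}}) \<in> spanning_trees E"
    using connected_exchange[OF tree(2) fs(2)] all_bridges_exchange[OF tree(3) fs] ij tree(1)
    by (auto simp: mem_spanning_trees_iff[of E, OF no_loops])
qed

text \<open>
  The exchange leaves the edges away from \<open>i\<close> untouched, so in the new tree the path from \<open>i\<close> to
  the old first step starts with \<open>j\<close>: exchanging twice restores the tree.
\<close>

lemma exchange_involution:
  assumes no_loops: "\<And>u. {u, u} \<notin> E" and T: "T \<in> spanning_trees E" and ij: "{i, j} \<in> E"
  shows "exchange i (exchange i (T, j)) = (T, j)"
proof -
  define k where "k = first_step T i j"
  define T' where "T' = insert {i, j} (T - {{i, k}})"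
  have "i \<noteq> j" using ij no_loops by auto
  moreover have tree: "graph_connected T" "all_bridges T"
    using T by (auto simp: mem_spanning_trees_iff[of E, OF no_loops])
  ultimately have fs: "{i, k} \<in> T" "(k, j) \<in> joined (avoiding i T)"
    unfolding k_def by (auto intro: first_step_props)
  have "all_bridges T'" unfolding T'_def by (rule all_bridges_exchange[OF tree(2) fs])
  moreover have "(j, k) \<in> joined (avoiding i T')"
    using fs(2) unfolding T'_def avoiding_exchange by (rule joined_sym)
  ultimately have first_step_back: "first_step T' i k = j"
    by (intro first_step_eq) (auto simp: T'_def)
  \<comment> \<open>If \<open>{i, j}\<close> is already a tree edge, it is itself the first step and \<open>T' = T\<close>.\<close>
  have "{i, j} \<in> T \<Longrightarrow> k = j"
    unfolding k_def using tree(2) by (intro first_step_eq joined_refl)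
  then have "insert {i, k} (T' - {{i, j}}) = T"
    using fs(1) unfolding T'_def by auto
  then show ?thesis
    using first_step_back by (simp add: exchange_def flip: k_def T'_def)
qed

section \<open>Potentials on trees\<close>

text \<open>
  Adding a bridge \<open>{u, v}\<close> to a forest keeps its potential solvable: shifting the potential by a
  constant on the component of \<open>u\<close> affects no edge of the forest, and it adjusts the
  difference between \<open>u\<close> and \<open>v\<close> freely because \<open>v\<close> lies in another component.
\<close>

lemma ex_forest_potential:
  fixes b :: "'v \<Rightarrow> 'v \<Rightarrow> real"
  assumes "finite F" "all_bridges F"
    and "\<And>e. e \<in> F \<Longrightarrow> \<exists>u v. e = {u, v}"
    and antisym: "\<And>i j. {i, j} \<in> F \<Longrightarrow> b j i = - b i j"
  shows "\<exists>y. \<forall>i j. {i, j} \<in> F \<longrightarrow> b i j = y i - y j"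
  using assms
proof (induction F rule: finite_induct)
  case empty
  show ?case by simp
next
  case (insert e F)
  obtain u v where e: "e = {u, v}" using insert.prems by blast
  have "all_bridges F" using insert.prems(1) by (rule all_bridges_mono) auto
  then obtain y where y: "\<And>i j. {i, j} \<in> F \<Longrightarrow> b i j = y i - y j"
    using insert.IH insert.prems by (metis insertCI)
  have "(u, v) \<notin> joined (insert e F - {e})"
    using insert.prems(1) e by (auto simp: all_bridges_def)
  then have sep: "(u, v) \<notin> joined F" using insert.hyps by simp
  define z where "z x = y x + (if (u, x) \<in> joined F then b u v - (y u - y v) else 0)" for x
  have uv: "b u v = z u - z v" using sep by (simp add: z_def joined_refl)
  have "b i j = z i - z j" if ij: "{i, j} \<in> insert e F" for i j
  proof (cases "{i, j} \<in> F")
    case True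
    then have "(u, i) \<in> joined F \<longleftrightarrow> (u, j) \<in> joined F"
      by (meson joined_edge joined_sym joined_trans)
    then show ?thesis using y[OF True] by (simp add: z_def)
  next
    case False
    then have "i = u \<and> j = v \<or> i = v \<and> j = u" using ij e by (auto simp: doubleton_eq_iff)
    then show ?thesis using uv insert.prems(3)[of u v] e by auto
  qed
  then show ?case by blast
qed

lemma joined_potentials_differ_by_constant:
  fixes b :: "'v \<Rightarrow> 'v \<Rightarrow> real"
  assumes "(u, v) \<in> joined F"
    and "\<And>i j. {i, j} \<in> F \<Longrightarrow> b i j = y i - y j"
    and "\<And>i j. {i, j} \<in> F \<Longrightarrow> b i j = z i - z j"
  shows "y u - z u = y v - z v"
  using assms(1)
proof (induction rule: joined_induct)
  case (step x w)
  then show ?case using assms(2,3)[of x w] by simp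
qed simp

section \<open>The averaged tree potential satisfies the normal equations\<close>

lemma exchange_residual:
  fixes b :: "'v \<Rightarrow> 'v \<Rightarrow> real"
  assumes no_loops: "\<And>u. {u, u} \<notin> E" and T: "T \<in> spanning_trees E" and ij: "{i, j} \<in> E"
    and pot: "\<And>T i j. T \<in> spanning_trees E \<Longrightarrow> {i, j} \<in> T \<Longrightarrow> b i j = y T i - y T j"
    and T': "exchange i (T, j) = (T', k)"
  shows "b i k - (y T' i - y T' k) = - (b i j - (y T i - y T j))"
proof -
  have k: "k = first_step T i j" and T'_eq: "T' = insert {i, j} (T - {{i, k}})"
    using T' by (auto simp: exchange_def)
  have T'_tree: "T' \<in> spanning_trees E"
    using exchange_spanning_tree(1)[OF no_loops T ij] by (simp add: T'_eq k)
  have "i \<noteq> j" using ij no_loops by auto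
  then have fs: "{i, k} \<in> T" "(k, j) \<in> joined (avoiding i T)"
    using first_step_props[of T i j] T
    by (auto simp: mem_spanning_trees_iff[of E, OF no_loops] k)
  \<comment> \<open>The two trees share the path between \<open>k\<close> and \<open>j\<close> that avoids \<open>i\<close>.\<close>
  have "y T k - y T' k = y T j - y T' j"
  proof (rule joined_potentials_differ_by_constant[OF fs(2)])
    fix p q assume pq: "{p, q} \<in> avoiding i T"
    then show "b p q = y T p - y T q" using pot[OF T] by (simp add: avoiding_def)
    have "{p, q} \<in> avoiding i T'" using pq by (simp add: T'_eq avoiding_exchange)
    then show "b p q = y T' p - y T' q" using pot[OF T'_tree] by (simp add: avoiding_def)
  qed
  moreover have "b i k = y T i - y T k" using pot[OF T fs(1)] .
  moreover have "b i j = y T' i - y T' j" using pot[OF T'_tree] by (simp add: T'_eq)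
  ultimately show ?thesis by simp
qed

lemma tree_residuals_sum_zero:
  fixes b :: "'v \<Rightarrow> 'v \<Rightarrow> real"
  assumes no_loops: "\<And>u. {u, u} \<notin> E"
    and pot: "\<And>T i j. T \<in> spanning_trees E \<Longrightarrow> {i, j} \<in> T \<Longrightarrow> b i j = y T i - y T j"
  shows "(\<Sum>T\<in>spanning_trees E. \<Sum>j | {i, j} \<in> E. b i j - (y T i - y T j)) = 0"
proof -
  define X where "X = spanning_trees E \<times> {j. {i, j} \<in> E}"
  define r where "r = (\<lambda>(T, j). b i j - (y T i - y T j))"
  have closed: "exchange i x \<in> X" if "x \<in> X" for x
    using that exchange_spanning_tree[OF no_loops] by (auto simp: X_def exchange_def)
  have inv: "exchange i (exchange i x) = x" if "x \<in> X" for x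
    using that exchange_involution[OF no_loops] by (auto simp: X_def)
  have neg: "r (exchange i x) = - r x" if x: "x \<in> X" for x
  proof -
    obtain T j where Tj: "x = (T, j)" "T \<in> spanning_trees E" "{i, j} \<in> E"
      using x by (auto simp: X_def)
    obtain T' k where "exchange i (T, j) = (T', k)" by fastforce
    then show ?thesis
      using exchange_residual[where y = y, OF no_loops Tj(2,3) pot] Tj(1) by (simp add: r_def)
  qed
  have "sum r X = (\<Sum>x\<in>X. r (exchange i x))"
    by (rule sum.reindex_bij_witness[of _ "exchange i" "exchange i"]) (auto simp: closed inv)
  also have "\<dots> = - sum r X" by (simp add: neg sum_negf)
  finally have "sum r X = 0" by simp
  then show ?thesis by (simp add: X_def r_def sum.cartesian_product)
qed

lemma normal_equations_average:
  fixes b :: "'v::finite \<Rightarrow> 'v \<Rightarrow> real"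
  assumes no_loops: "\<And>u. {u, u} \<notin> E" and conn: "graph_connected E"
    and pot: "\<And>T i j. T \<in> spanning_trees E \<Longrightarrow> {i, j} \<in> T \<Longrightarrow> b i j = y T i - y T j"
  defines "S \<equiv> real (card (spanning_trees E))"
  defines "avg \<equiv> \<lambda>i. (\<Sum>T\<in>spanning_trees E. y T i) / S"
  shows "(\<Sum>j | {i, j} \<in> E. b i j - (avg i - avg j)) = 0"
proof -
  have "S \<noteq> 0" using ex_spanning_tree[OF no_loops conn] by (simp add: S_def)
  have "b i j - (avg i - avg j) = (\<Sum>T\<in>spanning_trees E. b i j - (y T i - y T j)) / S" for j
  proof -
    have "(\<Sum>T\<in>spanning_trees E. b i j - (y T i - y T j)) = S * b i j - (S * avg i - S * avg j)"
      using \<open>S \<noteq> 0\<close> by (simp add: sum_subtractf avg_def S_def)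
    then show ?thesis using \<open>S \<noteq> 0\<close> by (simp add: field_simps)
  qed
  then have "(\<Sum>j | {i, j} \<in> E. b i j - (avg i - avg j))
    = (\<Sum>j | {i, j} \<in> E. \<Sum>T\<in>spanning_trees E. b i j - (y T i - y T j)) / S"
    by (simp add: sum_divide_distrib)
  also have "\<dots> = (\<Sum>T\<in>spanning_trees E. \<Sum>j | {i, j} \<in> E. b i j - (y T i - y T j)) / S"
    by (subst sum.swap) simp
  also have "\<dots> = 0"
    using tree_residuals_sum_zero[where E = E and b = b and y = y, OF no_loops pot] by simp
  finally show ?thesis .
qed

section \<open>Least squares on a graph\<close>

text \<open>
  The cross term of the expansion is \<open>\<Sum> r i j * (h i - h j)\<close>, with \<open>r\<close> the residuals. Summing the
  part with \<open>h i\<close> over \<open>j\<close> first gives zero by the normal equations, and the part with \<open>h j\<close>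
  reduces to it because \<open>r\<close> is antisymmetric.
\<close>

lemma least_squares_shift:
  fixes b :: "'v::finite \<Rightarrow> 'v \<Rightarrow> real" and K :: "('v \<times> 'v) set"
  assumes symK: "\<And>i j. (i, j) \<in> K \<Longrightarrow> (j, i) \<in> K"
    and antisym: "\<And>i j. (i, j) \<in> K \<Longrightarrow> b j i = - b i j"
    and normal: "\<And>i. (\<Sum>j | (i, j) \<in> K. b i j - (y i - y j)) = 0"
  shows "(\<Sum>(i, j)\<in>K. (b i j - (z i - z j))\<^sup>2) =
    (\<Sum>(i, j)\<in>K. (b i j - (y i - y j))\<^sup>2) + (\<Sum>(i, j)\<in>K. ((z i - y i) - (z j - y j))\<^sup>2)"
proof -
  define r where "r i j = b i j - (y i - y j)" for i j
  define h where "h i = z i - y i" for i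
  have K: "K = Sigma UNIV (\<lambda>i. {j. (i, j) \<in> K})" by auto
  have "(\<Sum>(i, j)\<in>K. r i j * h i) = (\<Sum>i\<in>UNIV. \<Sum>j | (i, j) \<in> K. r i j * h i)"
    by (subst K, subst sum.Sigma[symmetric]) auto
  also have "\<dots> = 0"
    using normal by (simp add: r_def flip: sum_distrib_right)
  finally have 1: "(\<Sum>(i, j)\<in>K. r i j * h i) = 0" .
  have r_antisym: "r j i = - r i j" if "(i, j) \<in> K" for i j
    using antisym[OF that] by (simp add: r_def)
  have "(\<Sum>(i, j)\<in>K. r i j * h j) = (\<Sum>(i, j)\<in>K. - (r i j * h i))"
  proof (rule sum.reindex_bij_witness[of _ prod.swap prod.swap])
    fix p assume p: "p \<in> K"
    show "prod.swap p \<in> K" using p symK by (cases p) simp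
    show "(case prod.swap p of (i, j) \<Rightarrow> - (r i j * h i)) = (case p of (i, j) \<Rightarrow> r i j * h j)"
      using p by (cases p) (simp add: r_antisym)
  qed (use symK in auto)
  also have "\<dots> = - (\<Sum>(i, j)\<in>K. r i j * h i)"
    by (simp add: sum_negf[symmetric] case_prod_beta)
  finally have 2: "(\<Sum>(i, j)\<in>K. r i j * h j) = 0" using 1 by simp
  have "(\<Sum>(i, j)\<in>K. (b i j - (z i - z j))\<^sup>2) =
    (\<Sum>(i, j)\<in>K. (r i j)\<^sup>2 + (h i - h j)\<^sup>2 - 2 * (r i j * h i) + 2 * (r i j * h j))"
    by (intro sum.cong refl) (auto simp: r_def h_def power2_eq_square algebra_simps)
  also have "\<dots> = (\<Sum>(i, j)\<in>K. (r i j)\<^sup>2) + (\<Sum>(i, j)\<in>K. (h i - h j)\<^sup>2)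
      - 2 * (\<Sum>(i, j)\<in>K. r i j * h i) + 2 * (\<Sum>(i, j)\<in>K. r i j * h j)"
    by (simp add: case_prod_beta sum.distrib sum_subtractf sum_distrib_left)
  finally show ?thesis using 1 2 by (simp add: r_def h_def)
qed

section \<open>Pairwise comparison matrices\<close>

definition log_entry :: "real option ^ 'n ^ 'n \<Rightarrow> 'n \<Rightarrow> 'n \<Rightarrow> real" where
  "log_entry A i j = ln (the (A $ i $ j))"

lemma comparison_graph_edge:
  assumes "pairwise_comparison_matrix A"
  shows "{i, j} \<in> comparison_graph A \<longleftrightarrow> i \<noteq> j \<and> A $ i $ j \<noteq> None"
  using assms unfolding comparison_graph_def pairwise_comparison_matrix_def
  by (fastforce simp: doubleton_eq_iff)

lemma log_entry_antisym:
  assumes "pairwise_comparison_matrix A" "A $ i $ j \<noteq> None"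
  shows "log_entry A j i = - log_entry A i j"
proof -
  obtain x y where "A $ i $ j = Some x" "A $ j $ i = Some y"
    using assms unfolding pairwise_comparison_matrix_def by blast
  moreover from this have "x > 0" "y > 0" "y = 1 / x"
    using assms(1) unfolding pairwise_comparison_matrix_def by blast+
  ultimately show ?thesis by (simp add: log_entry_def ln_div)
qed

lemma tree_weight_vector_iff_potential:
  assumes pcm: "pairwise_comparison_matrix A" and T: "T \<subseteq> comparison_graph A"
    and pos: "positive_vec w"
  shows "tree_weight_vector A T w \<longleftrightarrow>
    (\<forall>i j. {i, j} \<in> T \<longrightarrow> log_entry A i j = ln (w $ i) - ln (w $ j))"
proof -
  have "A $ i $ j = Some (w $ i / w $ j) \<longleftrightarrow> log_entry A i j = ln (w $ i) - ln (w $ j)"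
    if ij: "{i, j} \<in> T" for i j
  proof -
    have "A $ i $ j \<noteq> None" using ij T comparison_graph_edge[OF pcm] by blast
    then obtain x where x: "A $ i $ j = Some x" by blast
    have "x > 0" using x pcm by (auto simp: pairwise_comparison_matrix_def)
    moreover have w: "w $ i > 0" "w $ j > 0" using pos by (auto simp: positive_vec_def)
    ultimately have "x = w $ i / w $ j \<longleftrightarrow> ln x = ln (w $ i / w $ j)" by simp
    then show ?thesis using x w by (simp add: log_entry_def ln_div)
  qed
  then show ?thesis using pos by (auto simp: tree_weight_vector_def)
qed

lemma proportional_iff_ln_diff_constant:
  fixes u :: "real ^ 'n"
  assumes u: "positive_vec u" and g: "\<And>i. g i > 0"
  shows "(\<exists>c>0. \<forall>i. u $ i = c * g i) \<longleftrightarrow> (\<forall>i j. ln (u $ i) - ln (g i) = ln (u $ j) - ln (g j))"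
proof
  assume "\<exists>c>0. \<forall>i. u $ i = c * g i"
  then obtain c where "c > 0" "\<And>i. u $ i = c * g i" by blast
  moreover have "ln (c * g i) = ln c + ln (g i)" for i
    using \<open>c > 0\<close> g[of i] by (simp add: ln_mult_pos)
  ultimately show "\<forall>i j. ln (u $ i) - ln (g i) = ln (u $ j) - ln (g j)" by simp
next
  assume *: "\<forall>i j. ln (u $ i) - ln (g i) = ln (u $ j) - ln (g j)"
  \<comment> \<open>The constant is the ratio at an arbitrarily chosen index.\<close>
  let ?c = "u $ undefined / g undefined"
  have pos: "u $ i > 0" for i using u by (simp add: positive_vec_def)
  have "ln (u $ i / g i) = ln ?c" for i
    using *[rule_format, of i undefined] pos g by (simp add: ln_divide_pos)
  then have "u $ i / g i = ?c" for i using pos g by simp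
  then have "\<forall>i. u $ i = ?c * g i" using g by (metis less_irrefl nonzero_divide_eq_eq)
  then show "\<exists>c>0. \<forall>i. u $ i = c * g i" using pos g by (meson divide_pos_pos)
qed

lemma ex_tree_weight_vector:
  assumes pcm: "pairwise_comparison_matrix A" and T: "T \<in> spanning_trees (comparison_graph A)"
  shows "\<exists>v. tree_weight_vector A T v"
proof -
  have no_loops: "\<And>u. {u, u} \<notin> comparison_graph A" by (auto simp: comparison_graph_def doubleton_eq_iff)
  have tree: "T \<subseteq> comparison_graph A" "all_bridges T"
    using T mem_spanning_trees_iff[of _ T, OF no_loops] by auto
  obtain y where y: "\<And>i j. {i, j} \<in> T \<Longrightarrow> log_entry A i j = y i - y j"
  proof -
    have "\<exists>y. \<forall>i j. {i, j} \<in> T \<longrightarrow> log_entry A i j = y i - y j"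
    proof (rule ex_forest_potential[OF finite tree(2)])
      show "\<exists>u v. e = {u, v}" if "e \<in> T" for e
        using that tree(1) unfolding comparison_graph_def by blast
      show "log_entry A j i = - log_entry A i j" if "{i, j} \<in> T" for i j
        using that tree(1) comparison_graph_edge[OF pcm] log_entry_antisym[OF pcm] by blast
    qed
    then show ?thesis using that by blast
  qed
  let ?v = "(\<chi> i. exp (y i)) :: real ^ 'a"
  have "positive_vec ?v" by (simp add: positive_vec_def)
  then have "tree_weight_vector A T ?v"
    using y by (simp add: tree_weight_vector_iff_potential[OF pcm tree(1)])
  then show ?thesis by blast
qed

lemma tree_weight_vector_unique:
  assumes pcm: "pairwise_comparison_matrix A" and T: "T \<in> spanning_trees (comparison_graph A)"
    and v: "tree_weight_vector A T v"
  shows "tree_weight_vector A T u \<longleftrightarrow> (\<exists>c>0. u = c *\<^sub>R v)"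
proof
  have tree: "T \<subseteq> comparison_graph A" "graph_connected T"
    using T by (auto simp: spanning_trees_def graph_tree_def)
  have pos_v: "positive_vec v" using v by (simp add: tree_weight_vector_def)
  assume u: "tree_weight_vector A T u"
  then have pos_u: "positive_vec u" by (simp add: tree_weight_vector_def)
  have "ln (u $ i) - ln (v $ i) = ln (u $ j) - ln (v $ j)" for i j
  proof (rule joined_potentials_differ_by_constant)
    show "(i, j) \<in> joined T" using tree(2) by (simp add: graph_connected_iff_joined)
    show "log_entry A p q = ln (u $ p) - ln (u $ q)" if "{p, q} \<in> T" for p q
      using that u tree_weight_vector_iff_potential[OF pcm tree(1) pos_u] by blast
    show "log_entry A p q = ln (v $ p) - ln (v $ q)" if "{p, q} \<in> T" for p q
      using that v tree_weight_vector_iff_potential[OF pcm tree(1) pos_v] by blast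
  qed
  then have "\<exists>c>0. \<forall>i. u $ i = c * v $ i"
    using pos_v by (subst proportional_iff_ln_diff_constant[OF pos_u]) (auto simp: positive_vec_def)
  then show "\<exists>c>0. u = c *\<^sub>R v" by (simp add: vec_eq_iff)
next
  assume "\<exists>c>0. u = c *\<^sub>R v"
  then show "tree_weight_vector A T u"
    using v by (auto simp: tree_weight_vector_def positive_vec_def)
qed

lemma log_least_squares_eq:
  assumes "positive_vec w"
  shows "log_least_squares A w =
    (\<Sum>(i, j) \<in> {(i, j). A $ i $ j \<noteq> None}. (log_entry A i j - (ln (w $ i) - ln (w $ j)))\<^sup>2)"
  using assms unfolding log_least_squares_def log_entry_def positive_vec_def
  by (intro sum.cong refl) (auto simp: ln_divide_pos)

lemma lls_optimal_iff:
  assumes pcm: "pairwise_comparison_matrix A" and conn: "graph_connected (comparison_graph A)"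
    and normal: "\<And>i. (\<Sum>j | {i, j} \<in> comparison_graph A. log_entry A i j - (y i - y j)) = 0"
    and x: "positive_vec x"
  shows "lls_optimal A x \<longleftrightarrow> (\<forall>i j. ln (x $ i) - y i = ln (x $ j) - y j)"
proof -
  define K where "K = {(i, j). A $ i $ j \<noteq> None}"
  define D where "D z = (\<Sum>(i, j)\<in>K. ((z i - y i) - (z j - y j))\<^sup>2)" for z
  define m where "m = (\<Sum>(i, j)\<in>K. (log_entry A i j - (y i - y j))\<^sup>2)"
  have edge_iff: "{i, j} \<in> comparison_graph A \<longleftrightarrow> i \<noteq> j \<and> (i, j) \<in> K" for i j
    by (simp add: comparison_graph_edge[OF pcm] K_def)
  have diag: "log_entry A i i = 0" for i
    using pcm by (simp add: log_entry_def pairwise_comparison_matrix_def)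
  \<comment> \<open>The diagonal belongs to \<open>K\<close> but not to the graph; its residuals vanish.\<close>
  have normal_K: "(\<Sum>j | (i, j) \<in> K. log_entry A i j - (y i - y j)) = 0" for i
    by (rule trans[OF sum.mono_neutral_right normal[of i]]) (auto simp: edge_iff diag)
  have shift: "log_least_squares A w = m + D (\<lambda>i. ln (w $ i))" if "positive_vec w" for w
    unfolding log_least_squares_eq[OF that] m_def D_def K_def[symmetric]
  proof (rule least_squares_shift)
    fix i j assume "(i, j) \<in> K"
    then have "A $ i $ j \<noteq> None" by (simp add: K_def)
    then show "log_entry A j i = - log_entry A i j" by (rule log_entry_antisym[OF pcm])
    have "A $ j $ i \<noteq> None"
      using \<open>A $ i $ j \<noteq> None\<close> pcm unfolding pairwise_comparison_matrix_def by blast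
    then show "(j, i) \<in> K" by (simp add: K_def)
  qed (rule normal_K)
  have D_nonneg: "D z \<ge> 0" for z unfolding D_def by (intro sum_nonneg) auto
  have D_zero: "D z = 0 \<longleftrightarrow> (\<forall>i j. z i - y i = z j - y j)" for z
  proof
    assume "D z = 0"
    then have K_eq: "z i - y i = z j - y j" if "(i, j) \<in> K" for i j
      using that unfolding D_def by (subst (asm) sum_nonneg_eq_0_iff) auto
    have "z i - y i = z j - y j" if "(i, j) \<in> joined (comparison_graph A)" for i j
      using that by (induction rule: joined_induct) (use K_eq edge_iff in \<open>auto\<close>)
    then show "\<forall>i j. z i - y i = z j - y j"
      using conn by (simp add: graph_connected_iff_joined)
  next
    assume *: "\<forall>i j. z i - y i = z j - y j"
    show "D z = 0" unfolding D_def
      by (intro sum.neutral ballI) (use * in \<open>auto simp: case_prod_beta\<close>)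
  qed
  let ?e = "(\<chi> i. exp (y i)) :: real ^ 'a"
  have e: "positive_vec ?e" by (simp add: positive_vec_def)
  have "log_least_squares A ?e = m" using D_zero[of y] by (simp add: shift[OF e])
  then have "lls_optimal A x \<longleftrightarrow> log_least_squares A x \<le> m"
    using x e shift D_nonneg unfolding lls_optimal_def is_arg_min_linorder
    by (metis add_increasing2 order.refl order_trans)
  also have "\<dots> \<longleftrightarrow> D (\<lambda>i. ln (x $ i)) = 0"
    using shift[OF x] D_nonneg[of "\<lambda>i. ln (x $ i)"] by auto
  finally show ?thesis by (simp add: D_zero)
qed

theorem theorem2p1:
  fixes A :: "real option ^ 'n ^ 'n"
  assumes "pairwise_comparison_matrix A"
    and "graph_connected (comparison_graph A)"
  shows "(\<forall>T \<in> spanning_trees (comparison_graph A).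
            \<exists>v. tree_weight_vector A T v \<and>
                (\<forall>u. tree_weight_vector A T u \<longleftrightarrow> (\<exists>c>0. u = c *\<^sub>R v))) \<and>
         (\<forall>w :: 'n set set \<Rightarrow> real ^ 'n.
            (\<forall>T \<in> spanning_trees (comparison_graph A). tree_weight_vector A T (w T)) \<longrightarrow>
            (\<forall>x. positive_vec x \<longrightarrow>
               (lls_optimal A x \<longleftrightarrow>
                (\<exists>c>0. \<forall>i. x $ i =
                   c * root (card (spanning_trees (comparison_graph A)))
                         (\<Prod>T \<in> spanning_trees (comparison_graph A). w T $ i)))))"
proof (intro conjI ballI allI impI)
  fix T assume T: "T \<in> spanning_trees (comparison_graph A)"
  obtain v where v: "tree_weight_vector A T v"
    using ex_tree_weight_vector[OF assms(1) T] by blast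
  show "\<exists>v. tree_weight_vector A T v \<and>
      (\<forall>u. tree_weight_vector A T u \<longleftrightarrow> (\<exists>c>0. u = c *\<^sub>R v))"
    by (intro exI[of _ v] conjI allI v tree_weight_vector_unique[OF assms(1) T v])
next
  fix w :: "'n set set \<Rightarrow> real ^ 'n" and x :: "real ^ 'n"
  let ?E = "comparison_graph A"
  let ?TT = "spanning_trees ?E"
  assume w: "\<forall>T \<in> ?TT. tree_weight_vector A T (w T)" and x: "positive_vec x"
  have no_loops: "\<And>u. {u, u} \<notin> ?E" by (auto simp: comparison_graph_def doubleton_eq_iff)
  have S: "card ?TT > 0" using ex_spanning_tree[OF no_loops assms(2)] by (simp add: card_gt_0_iff)
  have pos: "w T $ i > 0" if "T \<in> ?TT" for T i
    using that w by (simp add: tree_weight_vector_def positive_vec_def)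
  have pot: "log_entry A i j = ln (w T $ i) - ln (w T $ j)" if "T \<in> ?TT" "{i, j} \<in> T" for T i j
  proof -
    have "T \<subseteq> ?E" using that by (simp add: spanning_trees_def)
    moreover have "positive_vec (w T)" using that pos by (simp add: positive_vec_def)
    ultimately show ?thesis using tree_weight_vector_iff_potential[OF assms(1)] that w by blast
  qed
  let ?g = "\<lambda>i. root (card ?TT) (\<Prod>T\<in>?TT. w T $ i)"
  have prod_pos: "(\<Prod>T\<in>?TT. w T $ i) > 0" for i using pos by (intro prod_pos) auto
  then have g: "?g i > 0" for i using S by simp
  have ln_g: "ln (?g i) = (\<Sum>T\<in>?TT. ln (w T $ i)) / card ?TT" for i
  proof -
    have "ln (\<Prod>T\<in>?TT. w T $ i) = (\<Sum>T\<in>?TT. ln (w T $ i))"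
      using pos by (intro ln_prod) (auto simp: less_imp_neq[symmetric])
    then show ?thesis using S prod_pos by (simp add: ln_root)
  qed
  have "lls_optimal A x \<longleftrightarrow> (\<forall>i j. ln (x $ i) - ln (?g i) = ln (x $ j) - ln (?g j))"
    unfolding ln_g
  proof (rule lls_optimal_iff[OF assms _ x])
    show "(\<Sum>j | {i, j} \<in> ?E. log_entry A i j
        - ((\<Sum>T\<in>?TT. ln (w T $ i)) / card ?TT - (\<Sum>T\<in>?TT. ln (w T $ j)) / card ?TT)) = 0" for i
      by (rule normal_equations_average[where y = "\<lambda>T i. ln (w T $ i)", OF no_loops assms(2) pot])
  qed
  also have "\<dots> \<longleftrightarrow> (\<exists>c>0. \<forall>i. x $ i = c * ?g i)"
    by (rule proportional_iff_ln_diff_constant[OF x g, symmetric])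
  finally show "lls_optimal A x \<longleftrightarrow> (\<exists>c>0. \<forall>i. x $ i = c * ?g i)" .
qed

end
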